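(* Let $K$ be a totally disconnected compact group and $\psi:K\to K$ a continuous surjective endomorphism. Then $$H_{top}(\psi,U)=\log[\psi^{-1}(U_-):U_-]\quad\text{and}\quad[\psi^{-1}(U_-):U_-]=[\psi(U_+):U_+]$$ for every $U\in\mathcal B_\triangleleft(K)$. In particular, $$h_{top}(\psi)=\sup\{\log[\psi^{-1}(U_-):U_-]:U\in\mathcal B_\triangleleft(K)\}.$$
   Context: $\mathcal B(K)$ is the family of all open subgroups of $K$ and $\mathcal B_\triangleleft(K)$ is the family of all open normal subgroups of $K$. For an open subgroup $U$ of $K$ and a positive integer $n$, $C_n(\psi,U)=U\cap\psi^{-1}(U)\cap\ldots\cap\psi^{-n+1}(U)$ is the $n$-th $\psi$-cotrajectory of $U$, and $C(\psi,U)=\bigcap_{n=1}^\infty C_n(\psi,U)=\bigcap_{n=0}^\infty\psi^{-n}(U)$ (preimages) is the $\psi$-cotrajectory of $U$. Write $U_-=C(\psi,U)$, and let $U_+=\bigcap_{n=0}^\infty\psi^n(U)$ (images), called the $\psi^{-1}$-cotrajectory of $U$ and also denoted $C(\psi^{-1},U)$. The topological entropy of $\psi$ with respect to $U$ is the limit (which exists) $H_{top}(\psi,U)=\lim_{n\to\infty}\frac{\log[K:C_n(\psi,U)]}{n}$, and the topological entropy of $\psi$ is $h_{top}(\psi)=\sup\{H_{top}(\psi,U):U\in\mathcal B(K)\}$.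
   Formalization: The equality [ψ^{-1}(U_-):U_-]=[ψ(U_+):U_+] is stated only for those U for which U_+ is a subgroup of ψ(U_+), since for non-injective ψ this can fail (one-sided shift over Z/2, U={x0=x1=x2+x3}) and the index [ψ(U_+):U_+] is then undefined. *)

theory Defs
  imports "HOL-Analysis.Analysis" "HOL-Algebra.Coset"
begin

locale topological_group = group K for K (structure) and T :: "'a topology" +
  assumes topspace_eq: "topspace T = carrier K"
    and continuous_mult: "continuous_map (prod_topology T T) T (\<lambda>(x, y). x \<otimes> y)"
    and continuous_inv: "continuous_map T T (\<lambda>x. inv x)"

definition totally_disconnected_space :: "'a topology \<Rightarrow> bool" where
  "totally_disconnected_space T \<longleftrightarrow> (\<forall>S. connectedin T S \<longrightarrow> (\<exists>x. S \<subseteq> {x}))"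

text \<open>As usual for topological groups, compactness includes the Hausdorff property.\<close>

locale td_compact_group = topological_group +
  assumes compact: "compact_space T"
    and Hausdorff: "Hausdorff_space T"
    and totally_disconnected: "totally_disconnected_space T"

definition open_subgroups :: "('a, 'b) monoid_scheme \<Rightarrow> 'a topology \<Rightarrow> 'a set set" where
  "open_subgroups K T = {U. subgroup U K \<and> openin T U}"

definition open_normal_subgroups :: "('a, 'b) monoid_scheme \<Rightarrow> 'a topology \<Rightarrow> 'a set set" where
  "open_normal_subgroups K T = {U. U \<lhd> K \<and> openin T U}"

text \<open>The index \<open>[A : B]\<close>. It is meaningful only if \<open>B\<close> is a subgroup of \<open>A\<close>; as \<open>card\<close> of an
  infinite set is 0, infinite indices are represented by \<open>\<infinity>\<close>.\<close>

definition subgroup_index :: "('a, 'b) monoid_scheme \<Rightarrow> 'a set \<Rightarrow> 'a set \<Rightarrow> enat" where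
  "subgroup_index K A B =
     (let Q = rcosets\<^bsub>K\<lparr>carrier := A\<rparr>\<^esub> B in if finite Q then enat (card Q) else \<infinity>)"

definition log_index :: "enat \<Rightarrow> ereal" where
  "log_index m = (case m of enat k \<Rightarrow> ereal (ln (real k)) | \<infinity> \<Rightarrow> \<infinity>)"

text \<open>The maps are only relevant on \<open>carrier K\<close>, so preimages are taken inside it.\<close>

definition cotraj_n :: "('a, 'b) monoid_scheme \<Rightarrow> ('a \<Rightarrow> 'a) \<Rightarrow> 'a set \<Rightarrow> nat \<Rightarrow> 'a set" where
  "cotraj_n K \<psi> U n = carrier K \<inter> (\<Inter>i<n. (\<psi> ^^ i) -` U)"

definition U_minus :: "('a, 'b) monoid_scheme \<Rightarrow> ('a \<Rightarrow> 'a) \<Rightarrow> 'a set \<Rightarrow> 'a set" where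
  "U_minus K \<psi> U = (\<Inter>n\<in>{1..}. cotraj_n K \<psi> U n)"

definition U_plus :: "('a \<Rightarrow> 'a) \<Rightarrow> 'a set \<Rightarrow> 'a set" where
  "U_plus \<psi> U = (\<Inter>n. (\<psi> ^^ n) ` U)"

definition H_top :: "('a, 'b) monoid_scheme \<Rightarrow> ('a \<Rightarrow> 'a) \<Rightarrow> 'a set \<Rightarrow> ereal" where
  "H_top K \<psi> U =
     lim (\<lambda>n. log_index (subgroup_index K (carrier K) (cotraj_n K \<psi> U n)) / ereal (real n))"

definition h_top :: "('a, 'b) monoid_scheme \<Rightarrow> 'a topology \<Rightarrow> ('a \<Rightarrow> 'a) \<Rightarrow> ereal" where
  "h_top K T \<psi> = (SUP U \<in> open_subgroups K T. H_top K \<psi> U)"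

text \<open>For non-injective surjective \<open>\<psi>\<close> the subgroup \<open>U_plus \<psi> U\<close> need not be contained in its image
  under \<open>\<psi>\<close>, even if \<open>U\<close> is open and normal: take the one-sided shift on the sequences over
  \<open>\<int>/2\<close> and \<open>U = {x. x\<^sub>0 = x\<^sub>1 \<and> x\<^sub>1 = x\<^sub>2 + x\<^sub>3}\<close>. The following predicate says that the index
  \<open>[\<psi>(U\<^sub>+) : U\<^sub>+]\<close> is defined.\<close>

definition U_plus_index_defined :: "('a, 'b) monoid_scheme \<Rightarrow> ('a \<Rightarrow> 'a) \<Rightarrow> 'a set \<Rightarrow> bool" where
  "U_plus_index_defined K \<psi> U \<longleftrightarrow>
     subgroup (U_plus \<psi> U) (K\<lparr>carrier := \<psi> ` U_plus \<psi> U\<rparr>)"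

end

theory Submission
  imports Defs
begin

text \<open>
  Write \<open>C\<^sub>n\<close> for the \<open>n\<close>-th cotrajectory of an open subgroup \<open>U\<close>. The proof counts the right
  cosets of \<open>U\<close> that meet a set \<open>A\<close>; if \<open>A\<close> is a subgroup, this is \<open>[A : A \<inter> U]\<close>. Since \<open>K\<close> is
  compact, there are only finitely many cosets of \<open>U\<close>, and for a decreasing sequence of closed
  sets the family of cosets met by them is eventually the family met by their intersection
  (\<open>meeting_cosets_decseq\<close>).

  Now \<open>C\<^bsub>n+1\<^esub>\<close> arises from smaller data in two ways: it is \<open>\<psi>\<^sup>-\<^sup>1(C\<^sub>n) \<inter> U\<close>, and it is
  \<open>C\<^sub>n \<inter> \<psi>\<^sup>-\<^sup>n(U)\<close>. As \<open>\<psi>\<close> is surjective, \<open>\<psi>\<^sup>-\<^sup>1(C\<^sub>n)\<close> has the same index as \<open>C\<^sub>n\<close>, and so the factor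
  \<open>[K : C\<^bsub>n+1\<^esub>] / [K : C\<^sub>n]\<close> is the number of cosets of \<open>U\<close> met by \<open>\<psi>\<^sup>-\<^sup>1(C\<^sub>n)\<close>, but also the number
  of those met by \<open>\<psi>\<^sup>n(C\<^sub>n)\<close> (\<open>index_cotraj_Suc\<close>, \<open>index_cotraj_Suc'\<close>). Both sequences of closed
  sets decrease. The first one has intersection \<open>\<psi>\<^sup>-\<^sup>1(U\<^sub>-)\<close>, so the factor is eventually
  constant with value \<open>[\<psi>\<^sup>-\<^sup>1(U\<^sub>-) : U\<^sub>-]\<close>, and the entropy is its logarithm. The second one has
  intersection \<open>\<psi>(U\<^sub>+)\<close> as soon as \<open>U\<^sub>+ \<subseteq> \<psi>(U\<^sub>+)\<close>, which gives \<open>[\<psi>(U\<^sub>+) : U\<^sub>+]\<close> for the same value.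

  The formula for the total entropy follows because the entropy cannot drop when \<open>U\<close> shrinks, and
  every open subgroup contains an open normal one, namely its normal core.
\<close>

section \<open>Cosets meeting a set\<close>

definition meeting_cosets :: "('a, 'b) monoid_scheme \<Rightarrow> 'a set \<Rightarrow> 'a set \<Rightarrow> 'a set set" where
  "meeting_cosets G U A = (\<lambda>a. U #>\<^bsub>G\<^esub> a) ` A"

context group
begin

lemma inv_cancel:
  assumes "x \<in> carrier G" "y \<in> carrier G"
  shows "inv x \<otimes> (x \<otimes> y) = y" "x \<otimes> (inv x \<otimes> y) = y"
  using assms by (simp_all flip: m_assoc)

lemma r_coset_eq_iff:
  assumes "subgroup U G" "x \<in> carrier G" "y \<in> carrier G"
  shows "U #> x = U #> y \<longleftrightarrow> x \<otimes> inv y \<in> U"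
proof
  assume "U #> x = U #> y"
  then have "x \<in> U #> y"
    using rcos_self[OF assms(2,1)] by simp
  then obtain u where "u \<in> U" "x = u \<otimes> y"
    by (auto simp: r_coset_def)
  then show "x \<otimes> inv y \<in> U"
    using assms by (metis inv_solve_right subgroup.mem_carrier)
next
  assume u: "x \<otimes> inv y \<in> U"
  have "x = (x \<otimes> inv y) \<otimes> y"
    using assms by (simp add: m_assoc)
  then have "x \<in> U #> y"
    using u by (auto simp: r_coset_def)
  then show "U #> x = U #> y"
    using assms repr_independence by metis
qed

text \<open>The second isomorphism theorem, as a statement about coset spaces: the cosets of \<open>A \<inter> U\<close> in
  \<open>A\<close> correspond to the cosets of \<open>U\<close> that meet \<open>A\<close>.\<close>

lemma subgroup_index_eq_card_meeting:
  assumes A: "subgroup A G" and U: "subgroup U G" and fin: "finite (meeting_cosets G U A)"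
  shows "subgroup_index G A (A \<inter> U) = enat (card (meeting_cosets G U A))"
proof -
  have Q: "rcosets\<^bsub>G\<lparr>carrier := A\<rparr>\<^esub> (A \<inter> U) = meeting_cosets G (A \<inter> U) A"
    by (auto simp: RCOSETS_def meeting_cosets_def r_coset_def)
  have AU: "subgroup (A \<inter> U) G"
    using A U by (rule subgroups_Inter_pair)
  have sub: "A \<subseteq> carrier G"
    using A by (rule subgroup.subset)
  have eq: "(A \<inter> U) #> x = (A \<inter> U) #> y \<longleftrightarrow> U #> x = U #> y" if "x \<in> A" "y \<in> A" for x y
  proof -
    have "x \<otimes> inv y \<in> A"
      using that A by (simp add: subgroup.m_closed subgroup.m_inv_closed)
    moreover have "x \<in> carrier G" "y \<in> carrier G"
      using that sub by auto
    ultimately show ?thesis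
      using r_coset_eq_iff[OF AU, of x y] r_coset_eq_iff[OF U, of x y] by simp
  qed
  obtain R where R: "R \<subseteq> A" "inj_on (\<lambda>a. U #> a) R"
      "meeting_cosets G U A = (\<lambda>a. U #> a) ` R"
    using subset_image_inj[of "meeting_cosets G U A" "\<lambda>a. U #> a" A]
    by (auto simp: meeting_cosets_def)
  then have inj: "inj_on (\<lambda>a. (A \<inter> U) #> a) R"
    using eq by (simp add: inj_on_def subset_iff)
  have img: "meeting_cosets G (A \<inter> U) A = (\<lambda>a. (A \<inter> U) #> a) ` R"
  proof
    show "meeting_cosets G (A \<inter> U) A \<subseteq> (\<lambda>a. (A \<inter> U) #> a) ` R"
    proof
      fix S assume "S \<in> meeting_cosets G (A \<inter> U) A"
      then obtain a where a: "a \<in> A" "S = (A \<inter> U) #> a"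
        by (auto simp: meeting_cosets_def)
      have "U #> a \<in> (\<lambda>a. U #> a) ` R"
        using a R(3) by (auto simp: meeting_cosets_def)
      then obtain r where r: "r \<in> R" "U #> a = U #> r"
        by auto
      then have "S = (A \<inter> U) #> r"
        using a R(1) eq[of a r] by blast
      then show "S \<in> (\<lambda>a. (A \<inter> U) #> a) ` R"
        using r by blast
    qed
  qed (use R in \<open>auto simp: meeting_cosets_def\<close>)
  have "finite R"
    using fin R finite_imageD by metis
  then have "finite (meeting_cosets G (A \<inter> U) A)"
    "card (meeting_cosets G (A \<inter> U) A) = card (meeting_cosets G U A)"
    using img R inj by (simp_all add: card_image)
  then show ?thesis
    by (simp add: subgroup_index_def Q)
qed

text \<open>Multiplicativity of the index, \<open>[G : A \<inter> U] = [G : A] \<sqdot> [A : A \<inter> U]\<close>: products of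
  representatives for the two factors represent the cosets of \<open>A \<inter> U\<close>.\<close>

lemma card_meeting_Int:
  assumes A: "subgroup A G" and U: "subgroup U G"
  shows "card (meeting_cosets G (A \<inter> U) (carrier G)) =
    card (meeting_cosets G A (carrier G)) * card (meeting_cosets G U A)"
proof -
  have AU: "subgroup (A \<inter> U) G"
    using A U by (rule subgroups_Inter_pair)
  obtain R where R: "R \<subseteq> carrier G" "inj_on (\<lambda>a. A #> a) R"
      "meeting_cosets G A (carrier G) = (\<lambda>a. A #> a) ` R"
    using subset_image_inj[of "meeting_cosets G A (carrier G)" "\<lambda>a. A #> a" "carrier G"]
    by (auto simp: meeting_cosets_def)
  obtain Q where Q: "Q \<subseteq> A" "inj_on (\<lambda>a. U #> a) Q" "meeting_cosets G U A = (\<lambda>a. U #> a) ` Q"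
    using subset_image_inj[of "meeting_cosets G U A" "\<lambda>a. U #> a" A]
    by (auto simp: meeting_cosets_def)
  have Ac: "a \<in> carrier G" if "a \<in> A" for a
    using that A by (simp add: subgroup.mem_carrier)
  have Rc: "r \<in> carrier G" if "r \<in> R" for r
    using that R by blast
  have QA: "q \<in> A" if "q \<in> Q" for q
    using that Q by blast
  define f where "f = (\<lambda>(r, q). (A \<inter> U) #> (q \<otimes> r))"
  have "bij_betw f (R \<times> Q) (meeting_cosets G (A \<inter> U) (carrier G))"
    unfolding bij_betw_def
  proof
    show "inj_on f (R \<times> Q)"
    proof (rule inj_onI, clarsimp simp: f_def)
      fix r q r' q'
      assume el: "r \<in> R" "q \<in> Q" "r' \<in> R" "q' \<in> Q"
        and eq: "(A \<inter> U) #> (q \<otimes> r) = (A \<inter> U) #> (q' \<otimes> r')"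
      note c = el(1,3)[THEN Rc] el(2,4)[THEN QA] el(2,4)[THEN QA, THEN Ac]
      have m: "(q \<otimes> r) \<otimes> inv (q' \<otimes> r') \<in> A \<inter> U"
        using eq r_coset_eq_iff[OF AU] c by simp
      have "inv q \<otimes> ((q \<otimes> r) \<otimes> inv (q' \<otimes> r')) \<otimes> q' \<in> A"
        using m c A by (simp add: subgroup.m_closed subgroup.m_inv_closed)
      also have "inv q \<otimes> ((q \<otimes> r) \<otimes> inv (q' \<otimes> r')) \<otimes> q' = r \<otimes> inv r'"
        using c by (simp add: inv_mult_group m_assoc inv_cancel)
      finally have r: "r = r'"
        using r_coset_eq_iff[OF A] c R(2) el by (simp add: inj_on_def)
      have "(q \<otimes> r) \<otimes> inv (q' \<otimes> r') = q \<otimes> inv q'"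
        using c unfolding r by (simp add: inv_mult_group m_assoc inv_cancel)
      then have "U #> q = U #> q'"
        using m r_coset_eq_iff[OF U] c by simp
      then show "r = r' \<and> q = q'"
        using r Q(2) el by (simp add: inj_on_def)
    qed
    show "f ` (R \<times> Q) = meeting_cosets G (A \<inter> U) (carrier G)"
    proof
      show "f ` (R \<times> Q) \<subseteq> meeting_cosets G (A \<inter> U) (carrier G)"
        by (auto simp: f_def meeting_cosets_def Rc QA Ac)
      show "meeting_cosets G (A \<inter> U) (carrier G) \<subseteq> f ` (R \<times> Q)"
      proof
        fix S assume "S \<in> meeting_cosets G (A \<inter> U) (carrier G)"
        then obtain g where g: "g \<in> carrier G" "S = (A \<inter> U) #> g"
          by (auto simp: meeting_cosets_def)
        have "A #> g \<in> (\<lambda>a. A #> a) ` R"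
          using g R(3) by (auto simp: meeting_cosets_def)
        then obtain r where r: "r \<in> R" "A #> g = A #> r"
          by auto
        define a where "a = g \<otimes> inv r"
        have a: "a \<in> A"
          using r g r_coset_eq_iff[OF A] Rc by (simp add: a_def)
        have "U #> a \<in> (\<lambda>a. U #> a) ` Q"
          using a Q(3) by (auto simp: meeting_cosets_def)
        then obtain q where q: "q \<in> Q" "U #> a = U #> q"
          by auto
        note c = Rc[OF r(1)] QA[OF q(1)] QA[OF q(1), THEN Ac] Ac[OF a] g(1)
        have "a \<otimes> inv q \<in> A \<inter> U"
          using q a c r_coset_eq_iff[OF U] A
          by (simp add: subgroup.m_closed subgroup.m_inv_closed)
        moreover have "a \<otimes> inv q = g \<otimes> inv (q \<otimes> r)"
          using c by (simp add: a_def inv_mult_group m_assoc)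
        ultimately have "S = f (r, q)"
          using g c r_coset_eq_iff[OF AU] by (simp add: f_def)
        then show "S \<in> f ` (R \<times> Q)"
          using r q by blast
      qed
    qed
  qed
  then have "card (meeting_cosets G (A \<inter> U) (carrier G)) = card R * card Q"
    by (simp add: bij_betw_same_card[symmetric] card_cartesian_product)
  then show ?thesis
    using R Q by (simp add: card_image)
qed

lemma subgroup_vimage_hom:
  assumes "\<phi> \<in> hom G G" "subgroup U G"
  shows "subgroup (\<phi> -` U \<inter> carrier G) G"
proof -
  interpret group_hom G G \<phi>
    by (unfold_locales) (rule assms)
  show ?thesis
  proof (rule subgroupI)
    show "\<phi> -` U \<inter> carrier G \<noteq> {}"
      using subgroup.one_closed[OF assms(2)] hom_one one_closed by blast
  qed (use assms(2) in \<open>auto simp: subgroup.m_closed subgroup.m_inv_closed\<close>)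
qed

lemma subgroup_image_hom:
  assumes "\<phi> \<in> hom G G" "subgroup U G"
  shows "subgroup (\<phi> ` U) G"
proof -
  interpret group_hom G G \<phi>
    by (unfold_locales) (rule assms)
  show ?thesis
    using assms(2) by (rule subgroup_img_is_subgroup)
qed

text \<open>A homomorphism \<open>\<phi>\<close> induces an injection of the cosets of \<open>\<phi>\<^sup>-\<^sup>1(U)\<close> into the cosets of \<open>U\<close>.\<close>

lemma card_meeting_vimage_hom:
  assumes hom: "\<phi> \<in> hom G G" and U: "subgroup U G" and A: "A \<subseteq> carrier G"
  shows "card (meeting_cosets G (\<phi> -` U \<inter> carrier G) A) = card (meeting_cosets G U (\<phi> ` A))"
proof -
  interpret h: group_hom G G \<phi>
    by (unfold_locales) (rule hom)
  let ?V = "\<phi> -` U \<inter> carrier G"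
  have V: "subgroup ?V G"
    using hom U by (rule subgroup_vimage_hom)
  have eq: "?V #> x = ?V #> y \<longleftrightarrow> U #> \<phi> x = U #> \<phi> y" if "x \<in> A" "y \<in> A" for x y
  proof -
    have "x \<in> carrier G" "y \<in> carrier G"
      using that A by auto
    then show ?thesis
      using r_coset_eq_iff[OF V] r_coset_eq_iff[OF U] by simp
  qed
  obtain R where R: "R \<subseteq> A" "inj_on (\<lambda>a. ?V #> a) R" "meeting_cosets G ?V A = (\<lambda>a. ?V #> a) ` R"
    using subset_image_inj[of "meeting_cosets G ?V A" "\<lambda>a. ?V #> a" A]
    by (auto simp: meeting_cosets_def)
  have "inj_on (\<lambda>a. U #> \<phi> a) R"
    using R eq by (simp add: inj_on_def subset_iff)
  moreover have "meeting_cosets G U (\<phi> ` A) = (\<lambda>a. U #> \<phi> a) ` R"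
  proof
    show "meeting_cosets G U (\<phi> ` A) \<subseteq> (\<lambda>a. U #> \<phi> a) ` R"
    proof
      fix S assume "S \<in> meeting_cosets G U (\<phi> ` A)"
      then obtain a where a: "a \<in> A" "S = U #> \<phi> a"
        by (auto simp: meeting_cosets_def)
      have "?V #> a \<in> (\<lambda>a. ?V #> a) ` R"
        using a R(3) by (auto simp: meeting_cosets_def)
      then obtain r where r: "r \<in> R" "?V #> a = ?V #> r"
        by auto
      then have "S = U #> \<phi> r"
        using a R(1) eq[of a r] by blast
      then show "S \<in> (\<lambda>a. U #> \<phi> a) ` R"
        using r(1) by blast
    qed
  qed (use R in \<open>auto simp: meeting_cosets_def\<close>)
  ultimately show ?thesis
    using R by (simp add: card_image)
qed

lemma card_meeting_antimono:
  assumes U: "subgroup U G" and V: "subgroup V G" and "V \<subseteq> U" and A: "A \<subseteq> carrier G"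
    and fin: "finite (meeting_cosets G V A)"
  shows "card (meeting_cosets G U A) \<le> card (meeting_cosets G V A)"
proof (rule surj_card_le[OF fin, where f = "\<lambda>S. U #> (SOME a. a \<in> A \<and> S = V #> a)"], rule subsetI)
  fix S assume "S \<in> meeting_cosets G U A"
  then obtain a where a: "a \<in> A" "S = U #> a"
    by (auto simp: meeting_cosets_def)
  let ?b = "SOME b. b \<in> A \<and> V #> a = V #> b"
  have b: "?b \<in> A \<and> V #> a = V #> ?b"
    by (rule someI[where x = a]) (use a in simp)
  then have "a \<otimes> inv ?b \<in> V"
    using a A r_coset_eq_iff[OF V] by blast
  then have "U #> a = U #> ?b"
    using a b A \<open>V \<subseteq> U\<close> r_coset_eq_iff[OF U] by blast
  then show "S \<in> (\<lambda>S. U #> (SOME a. a \<in> A \<and> S = V #> a)) ` meeting_cosets G V A"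
    using a by (auto simp: meeting_cosets_def)
qed

end

section \<open>Open subgroups of compact groups\<close>

context topological_group
begin

lemma mem_topspace_iff [simp]: "x \<in> topspace T \<longleftrightarrow> x \<in> carrier K"
  by (simp add: topspace_eq)

lemma continuous_map_mult:
  assumes "continuous_map X T f" "continuous_map X T g"
  shows "continuous_map X T (\<lambda>x. f x \<otimes> g x)"
proof -
  have "continuous_map X (prod_topology T T) (\<lambda>x. (f x, g x))"
    using assms by (simp add: continuous_map_pairwise o_def)
  from continuous_map_compose[OF this continuous_mult] show ?thesis
    by (simp add: o_def)
qed

lemma openin_r_coset:
  assumes U: "subgroup U K" "openin T U" and a: "a \<in> carrier K"
  shows "openin T (U #> a)"
proof -
  have "continuous_map T T (\<lambda>x. x \<otimes> inv a)"
    using a by (intro continuous_map_mult) auto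
  then have "openin T {x \<in> topspace T. x \<otimes> inv a \<in> U}"
    using U(2) by (rule openin_continuous_map_preimage)
  also have "{x \<in> topspace T. x \<otimes> inv a \<in> U} = U #> a"
  proof (intro Set.set_eqI iffI)
    fix x assume "x \<in> {x \<in> topspace T. x \<otimes> inv a \<in> U}"
    then have x: "x \<in> carrier K" "x \<otimes> inv a \<in> U"
      by auto
    then have "x \<in> U #> x" "U #> x = U #> a"
      using a U rcos_self r_coset_eq_iff by auto
    then show "x \<in> U #> a"
      by simp
  next
    fix x assume "x \<in> U #> a"
    then obtain u where u: "u \<in> U" "x = u \<otimes> a"
      by (auto simp: r_coset_def)
    moreover have "u \<in> carrier K"
      using u U by (simp add: subgroup.mem_carrier)
    ultimately show "x \<in> {x \<in> topspace T. x \<otimes> inv a \<in> U}"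
      using a by (simp add: m_assoc)
  qed
  finally show ?thesis .
qed

text \<open>The complement of a coset is a union of cosets, hence open.\<close>

lemma closedin_r_coset:
  assumes U: "subgroup U K" "openin T U" and a: "a \<in> carrier K"
  shows "closedin T (U #> a)"
proof -
  have sub: "U #> a \<subseteq> topspace T"
    using openin_r_coset[OF assms] by (rule openin_subset)
  have "topspace T - (U #> a) = \<Union> {U #> b | b. b \<in> carrier K \<and> U #> b \<noteq> U #> a}" (is "?L = ?R")
  proof (intro Set.set_eqI iffI)
    fix x assume x: "x \<in> ?L"
    then have "x \<in> U #> x" "U #> x \<noteq> U #> a"
      using rcos_self[OF _ U(1)] by auto
    then show "x \<in> ?R"
      using x by auto
  next
    fix x assume "x \<in> ?R"
    then obtain b where b: "b \<in> carrier K" "U #> b \<noteq> U #> a" "x \<in> U #> b"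
      by auto
    then have "x \<in> carrier K"
      using openin_subset[OF openin_r_coset[OF U b(1)]] by auto
    moreover have "x \<notin> U #> a"
      using b a U repr_independence by metis
    ultimately show "x \<in> ?L"
      by simp
  qed
  also have "openin T \<dots>"
    using openin_r_coset[OF U] by blast
  finally show ?thesis
    using sub by (simp add: closedin_def)
qed

lemma closedin_open_subgroup:
  assumes "subgroup U K" "openin T U"
  shows "closedin T U"
  using closedin_r_coset[OF assms one_closed] coset_mult_one subgroup.subset[OF assms(1)] by simp

lemma finite_meeting_cosets:
  assumes cpt: "compact_space T" and U: "subgroup U K" "openin T U" and A: "A \<subseteq> carrier K"
  shows "finite (meeting_cosets K U A)"
proof -
  let ?C = "meeting_cosets K U (carrier K)"
  have "topspace T \<subseteq> \<Union> ?C"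
    using rcos_self[OF _ U(1)] by (auto simp: meeting_cosets_def)
  moreover have "\<forall>S\<in>?C. openin T S"
    using openin_r_coset[OF U] by (auto simp: meeting_cosets_def)
  ultimately obtain F where F: "finite F" "F \<subseteq> ?C" "topspace T \<subseteq> \<Union> F"
    using cpt unfolding compact_space_alt by meson
  have "?C \<subseteq> F"
  proof
    fix S assume "S \<in> ?C"
    then obtain a where a: "a \<in> carrier K" "S = U #> a"
      by (auto simp: meeting_cosets_def)
    then obtain S' where S': "S' \<in> F" "a \<in> S'"
      using F(3) by (auto simp: topspace_eq)
    then obtain b where "b \<in> carrier K" "S' = U #> b"
      using F(2) by (auto simp: meeting_cosets_def)
    then have "S = S'"
      using a S' U repr_independence by metis
    then show "S \<in> F"
      using S' by simp
  qed
  moreover have "meeting_cosets K U A \<subseteq> ?C"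
    using A by (auto simp: meeting_cosets_def)
  ultimately show ?thesis
    using F(1) by (meson finite_subset)
qed

text \<open>A coset that meets every \<open>A n\<close> meets the intersection, by compactness. The other cosets, being
  finitely many, are all missed from some index on.\<close>

lemma meeting_cosets_decseq:
  assumes cpt: "compact_space T" and U: "subgroup U K" "openin T U"
    and closed: "\<And>n. closedin T (A n)" and dec: "decseq A"
  shows "\<exists>N. \<forall>n\<ge>N. meeting_cosets K U (A n) = meeting_cosets K U (\<Inter>n. A n)"
proof -
  let ?C = "meeting_cosets K U (carrier K)" and ?M = "meeting_cosets K U (\<Inter>n. A n)"
  have sub: "A n \<subseteq> carrier K" for n
    using closedin_subset[OF closed] by (simp add: topspace_eq)
  have meets: "S \<in> meeting_cosets K U B \<longleftrightarrow> S \<inter> B \<noteq> {}" if "S \<in> ?C" "B \<subseteq> carrier K" for S B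
  proof
    assume "S \<in> meeting_cosets K U B"
    then obtain b where "b \<in> B" "S = U #> b"
      by (auto simp: meeting_cosets_def)
    then show "S \<inter> B \<noteq> {}"
      using that rcos_self[OF _ U(1), of b] by auto
  next
    assume "S \<inter> B \<noteq> {}"
    then obtain b where b: "b \<in> B" "b \<in> S"
      by auto
    then have "S = U #> b"
      using that U repr_independence by (auto simp: meeting_cosets_def)
    then show "S \<in> meeting_cosets K U B"
      using b by (auto simp: meeting_cosets_def)
  qed
  have "\<exists>n. S \<notin> meeting_cosets K U (A n)" if S: "S \<in> ?C - ?M" for S
  proof (rule ccontr)
    assume "\<not> ?thesis"
    then have "S \<inter> A n \<noteq> {}" for n
      using meets[of S "A n"] S sub by auto
    moreover have "closedin T (S \<inter> A n)" for n
      using S closedin_r_coset[OF U] closed by (auto simp: meeting_cosets_def)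
    moreover have "decseq (\<lambda>n. S \<inter> A n)"
      using dec by (auto simp: decseq_def)
    ultimately have "(\<Inter>n. S \<inter> A n) \<noteq> {}"
      using cpt by (intro compact_space_imp_nest) auto
    then have "S \<inter> (\<Inter>n. A n) \<noteq> {}"
      by auto
    then show False
      using meets[of S "\<Inter>n. A n"] S sub by auto
  qed
  then obtain k where k: "S \<notin> meeting_cosets K U (A (k S))" if "S \<in> ?C - ?M" for S
    by metis
  have fin: "finite (k ` (?C - ?M))"
    using finite_meeting_cosets[OF cpt U order_refl] by simp
  show ?thesis
  proof (intro exI allI impI)
    fix n assume n: "n \<ge> Max (insert 0 (k ` (?C - ?M)))"
    have "S \<in> ?M" if S: "S \<in> meeting_cosets K U (A n)" for S
    proof (rule ccontr)
      assume "S \<notin> ?M"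
      moreover have "S \<in> ?C"
        using S sub[of n] by (auto simp: meeting_cosets_def)
      ultimately have SC: "S \<in> ?C - ?M"
        by simp
      then have "k S \<le> n"
        using n fin by auto
      then have "A n \<subseteq> A (k S)"
        using dec by (simp add: decseq_def)
      then show False
        using k[OF SC] S by (auto simp: meeting_cosets_def)
    qed
    then show "meeting_cosets K U (A n) = ?M"
      by (auto simp: meeting_cosets_def)
  qed
qed

text \<open>The normal core of \<open>U\<close> is open because the condition \<open>x g x\<^sup>-\<^sup>1 \<in> U\<close> depends only on the coset
  \<open>U x\<close>, so that finitely many such conditions suffice.\<close>

lemma open_normal_subgroup_below:
  assumes cpt: "compact_space T" and U: "subgroup U K" "openin T U"
  obtains N where "N \<in> open_normal_subgroups K T" "N \<subseteq> U"
proof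
  define N where "N = {g \<in> carrier K. \<forall>x\<in>carrier K. x \<otimes> g \<otimes> inv x \<in> U}"
  have conj_mult: "x \<otimes> (g \<otimes> h) \<otimes> inv x = (x \<otimes> g \<otimes> inv x) \<otimes> (x \<otimes> h \<otimes> inv x)"
    if "x \<in> carrier K" "g \<in> carrier K" "h \<in> carrier K" for x g h
    using that by (simp add: m_assoc inv_cancel)
  have conj_inv: "x \<otimes> inv g \<otimes> inv x = inv (x \<otimes> g \<otimes> inv x)"
    if "x \<in> carrier K" "g \<in> carrier K" for x g
    using that by (simp add: m_assoc inv_mult_group)
  show "N \<subseteq> U"
  proof
    fix g assume "g \<in> N"
    then have "g \<in> carrier K" "\<one> \<otimes> g \<otimes> inv \<one> \<in> U"
      unfolding N_def by blast+
    then show "g \<in> U"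
      by simp
  qed
  have subgroup: "subgroup N K"
  proof (rule subgroupI)
    show "N \<noteq> {}"
      using subgroup.one_closed[OF U(1)] by (auto simp: N_def intro!: exI[of _ \<one>])
    show "inv g \<in> N" if "g \<in> N" for g
      using that U by (auto simp: N_def conj_inv subgroup.m_inv_closed)
    show "g \<otimes> h \<in> N" if "g \<in> N" "h \<in> N" for g h
      using that U by (auto simp: N_def conj_mult subgroup.m_closed)
  qed (auto simp: N_def)
  have "x \<otimes> h \<otimes> inv x \<in> N" if x: "x \<in> carrier K" and h: "h \<in> N" for x h
  proof -
    have hc: "h \<in> carrier K"
      using h by (simp add: N_def)
    have "y \<otimes> (x \<otimes> h \<otimes> inv x) \<otimes> inv y \<in> U" if y: "y \<in> carrier K" for y
    proof -
      have "(y \<otimes> x) \<otimes> h \<otimes> inv (y \<otimes> x) \<in> U"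
        using h x y by (simp add: N_def)
      then show ?thesis
        using x y hc by (simp add: inv_mult_group m_assoc)
    qed
    then show ?thesis
      using x hc by (simp add: N_def)
  qed
  then have normal: "N \<lhd> K"
    using subgroup by (simp add: normal_inv_iff)
  obtain R where R: "R \<subseteq> carrier K" "finite R"
      "meeting_cosets K U (carrier K) = (\<lambda>a. U #> a) ` R"
    using finite_subset_image[OF finite_meeting_cosets[OF cpt U order_refl], of "\<lambda>a. U #> a" "carrier K"]
    by (auto simp: meeting_cosets_def)
  have "N = topspace T \<inter> (\<Inter>r\<in>R. {g \<in> topspace T. r \<otimes> g \<otimes> inv r \<in> U})" (is "_ = ?I")
  proof (intro Set.set_eqI iffI)
    fix g assume g: "g \<in> ?I"
    have "x \<otimes> g \<otimes> inv x \<in> U" if x: "x \<in> carrier K" for x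
    proof -
      have "U #> x \<in> (\<lambda>a. U #> a) ` R"
        using x R(3) by (auto simp: meeting_cosets_def)
      then obtain r where r: "r \<in> R" "U #> x = U #> r"
        by auto
      have rc: "r \<in> carrier K" and gc: "g \<in> carrier K" and rU: "r \<otimes> g \<otimes> inv r \<in> U"
        using r g R(1) by auto
      have u: "x \<otimes> inv r \<in> U"
        using r rc x U r_coset_eq_iff by simp
      have "(x \<otimes> inv r) \<otimes> (r \<otimes> g \<otimes> inv r) \<otimes> inv (x \<otimes> inv r) \<in> U"
        using u rU U by (simp add: subgroup.m_closed subgroup.m_inv_closed)
      also have "(x \<otimes> inv r) \<otimes> (r \<otimes> g \<otimes> inv r) \<otimes> inv (x \<otimes> inv r) = x \<otimes> g \<otimes> inv x"
        using x rc gc by (simp add: inv_mult_group m_assoc inv_cancel)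
      finally show ?thesis .
    qed
    then show "g \<in> N"
      using g by (simp add: N_def)
  qed (use R(1) in \<open>auto simp: N_def\<close>)
  moreover have "openin T {g \<in> topspace T. r \<otimes> g \<otimes> inv r \<in> U}" if "r \<in> R" for r
  proof -
    have "r \<in> carrier K"
      using that R(1) by blast
    then have "continuous_map T T (\<lambda>g. r \<otimes> g \<otimes> inv r)"
      by (intro continuous_map_mult) auto
    then show ?thesis
      using U(2) by (rule openin_continuous_map_preimage)
  qed
  ultimately have "openin T N"
    using R(2) by (cases "R = {}") (auto intro!: openin_Int openin_INT2)
  then show "N \<in> open_normal_subgroups K T"
    using normal by (simp add: open_normal_subgroups_def)
qed

end

section \<open>Growth of the index of the cotrajectories\<close>

locale compact_group_epimorphism = topological_group +
  fixes \<psi> :: "'a \<Rightarrow> 'a"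
  assumes compact: "compact_space T"
    and Hausdorff: "Hausdorff_space T"
    and hom: "\<psi> \<in> hom K K"
    and cont: "continuous_map T T \<psi>"
    and surj: "\<psi> ` carrier K = carrier K"
begin

lemma funpow_hom: "\<psi> ^^ n \<in> hom K K"
  by (induction n) (use hom in \<open>auto simp: hom_def Pi_iff\<close>)

lemma funpow_cont: "continuous_map T T (\<psi> ^^ n)"
  by (induction n) (use cont in \<open>auto intro: continuous_map_compose simp: id_def simp del: o_apply\<close>)

lemma funpow_closed [simp]: "x \<in> carrier K \<Longrightarrow> (\<psi> ^^ n) x \<in> carrier K"
  using funpow_hom by (auto simp: hom_def)

lemma psi_closed [simp]: "x \<in> carrier K \<Longrightarrow> \<psi> x \<in> carrier K"
  using hom by (auto simp: hom_def)

lemma closedin_image: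
  assumes "closedin T A"
  shows "closedin T ((\<psi> ^^ n) ` A)"
  using assms compact Hausdorff funpow_cont
  by (meson closedin_compact_space compactin_imp_closedin image_compactin)

lemma closedin_vimage:
  assumes "closedin T A"
  shows "closedin T (\<psi> -` A \<inter> carrier K)"
proof -
  have "closedin T {x \<in> topspace T. \<psi> x \<in> A}"
    using cont assms by (rule closedin_continuous_map_preimage)
  also have "{x \<in> topspace T. \<psi> x \<in> A} = \<psi> -` A \<inter> carrier K"
    by auto
  finally show ?thesis .
qed

lemma cotraj_0: "cotraj_n K \<psi> U 0 = carrier K"
  by (simp add: cotraj_n_def)

lemma cotraj_Suc:
  "cotraj_n K \<psi> U (Suc n) = cotraj_n K \<psi> U n \<inter> ((\<psi> ^^ n) -` U \<inter> carrier K)"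
  by (auto simp: cotraj_n_def lessThan_Suc)

lemma cotraj_Suc':
  "cotraj_n K \<psi> U (Suc n) = (\<psi> -` cotraj_n K \<psi> U n \<inter> carrier K) \<inter> U"
  by (auto simp: cotraj_n_def lessThan_Suc_eq_insert_0 funpow_swap1)

lemma decseq_cotraj: "decseq (cotraj_n K \<psi> U)"
  by (rule decseq_SucI) (auto simp: cotraj_Suc)

lemma cotraj_mono: "V \<subseteq> U \<Longrightarrow> cotraj_n K \<psi> V n \<subseteq> cotraj_n K \<psi> U n"
  by (auto simp: cotraj_n_def)

lemma U_minus_eq: "U_minus K \<psi> U = (\<Inter>n. cotraj_n K \<psi> U n)"
proof -
  have "x \<in> cotraj_n K \<psi> U n" if "\<forall>m\<in>{1..}. x \<in> cotraj_n K \<psi> U m" for x n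
    using that decseq_cotraj[THEN decseqD, of n "Suc n"] by auto
  then show ?thesis
    by (auto simp: U_minus_def)
qed

lemma vimage_U_minus:
  "\<psi> -` U_minus K \<psi> U \<inter> carrier K = (\<Inter>n. \<psi> -` cotraj_n K \<psi> U n \<inter> carrier K)"
  by (auto simp: U_minus_eq)

lemma U_minus_eq_Int: "U_minus K \<psi> U = (\<psi> -` U_minus K \<psi> U \<inter> carrier K) \<inter> U"
proof -
  have "U_minus K \<psi> U = (\<Inter>n. cotraj_n K \<psi> U (Suc n))"
    unfolding U_minus_eq using decseq_cotraj[THEN decseqD, OF le_SucI[OF order_refl]] by blast
  then show ?thesis
    unfolding vimage_U_minus by (auto simp: cotraj_Suc')
qed

context
  fixes U
  assumes U: "subgroup U K" "openin T U"
begin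

lemma cotraj_open_subgroup:
  "subgroup (cotraj_n K \<psi> U n) K \<and> openin T (cotraj_n K \<psi> U n)"
proof (induction n)
  case 0
  show ?case
    using openin_topspace[of T] by (simp add: cotraj_0 subgroup_self topspace_eq)
next
  case (Suc n)
  have "openin T {x \<in> topspace T. (\<psi> ^^ n) x \<in> U}"
    using funpow_cont U(2) by (rule openin_continuous_map_preimage)
  also have "{x \<in> topspace T. (\<psi> ^^ n) x \<in> U} = (\<psi> ^^ n) -` U \<inter> carrier K"
    by auto
  finally show ?case
    using Suc subgroup_vimage_hom[OF funpow_hom U(1), of n]
    by (auto simp: cotraj_Suc intro: subgroups_Inter_pair)
qed

lemmas subgroup_cotraj = cotraj_open_subgroup[THEN conjunct1]
lemmas openin_cotraj = cotraj_open_subgroup[THEN conjunct2]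

lemma closedin_cotraj: "closedin T (cotraj_n K \<psi> U n)"
  using subgroup_cotraj openin_cotraj by (rule closedin_open_subgroup)

definition cotraj_index :: "nat \<Rightarrow> nat" where
  "cotraj_index n = card (meeting_cosets K (cotraj_n K \<psi> U n) (carrier K))"

lemma cotraj_index_pos: "cotraj_index n > 0"
  unfolding cotraj_index_def card_gt_0_iff
  using finite_meeting_cosets[OF compact subgroup_cotraj openin_cotraj order_refl]
  by (auto simp: meeting_cosets_def)

lemma subgroup_index_cotraj:
  "subgroup_index K (carrier K) (cotraj_n K \<psi> U n) = enat (cotraj_index n)"
proof -
  have "carrier K \<inter> cotraj_n K \<psi> U n = cotraj_n K \<psi> U n"
    by (auto simp: cotraj_n_def)
  then show ?thesis
    using subgroup_index_eq_card_meeting[OF subgroup_self subgroup_cotraj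
      finite_meeting_cosets[OF compact subgroup_cotraj openin_cotraj order_refl]]
    by (metis cotraj_index_def)
qed

text \<open>The index of \<open>\<psi>\<^sup>-\<^sup>1(C\<^sub>n)\<close> equals that of \<open>C\<^sub>n\<close>; this is where surjectivity of \<open>\<psi>\<close> enters.\<close>

lemma index_cotraj_Suc:
  "cotraj_index (Suc n) =
    cotraj_index n * card (meeting_cosets K U (\<psi> -` cotraj_n K \<psi> U n \<inter> carrier K))"
proof -
  have "card (meeting_cosets K (\<psi> -` cotraj_n K \<psi> U n \<inter> carrier K) (carrier K)) = cotraj_index n"
    using card_meeting_vimage_hom[OF hom subgroup_cotraj order_refl] surj
    by (simp add: cotraj_index_def)
  then show ?thesis
    using card_meeting_Int[OF subgroup_vimage_hom[OF hom subgroup_cotraj] U(1)]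
    by (simp add: cotraj_index_def cotraj_Suc')
qed

lemma index_cotraj_Suc':
  "cotraj_index (Suc n) =
    cotraj_index n * card (meeting_cosets K U ((\<psi> ^^ n) ` cotraj_n K \<psi> U n))"
  using card_meeting_Int[OF subgroup_cotraj subgroup_vimage_hom[OF funpow_hom U(1)]]
    card_meeting_vimage_hom[OF funpow_hom U(1) subgroup.subset[OF subgroup_cotraj]]
  by (simp add: cotraj_index_def cotraj_Suc)

abbreviation growth_factor :: nat where
  "growth_factor \<equiv> card (meeting_cosets K U (\<psi> -` U_minus K \<psi> U \<inter> carrier K))"

lemma subgroup_U_minus: "subgroup (U_minus K \<psi> U) K"
  unfolding U_minus_eq
proof (rule subgroups_Inter)
  show "subgroup H K" if "H \<in> range (cotraj_n K \<psi> U)" for H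
    using that subgroup_cotraj by blast
qed simp

lemma subgroup_index_U_minus:
  "subgroup_index K (\<psi> -` U_minus K \<psi> U \<inter> carrier K) (U_minus K \<psi> U) = enat growth_factor"
proof -
  have "subgroup (\<psi> -` U_minus K \<psi> U \<inter> carrier K) K"
    using hom subgroup_U_minus by (rule subgroup_vimage_hom)
  from subgroup_index_eq_card_meeting[OF this U(1)
      finite_meeting_cosets[OF compact U Int_lower2]]
  show ?thesis
    by (simp flip: U_minus_eq_Int)
qed

lemma growth_factor_pos: "growth_factor > 0"
proof -
  have "\<one> \<in> \<psi> -` U_minus K \<psi> U \<inter> carrier K"
    using subgroup_vimage_hom[OF hom subgroup_U_minus] by (rule subgroup.one_closed)
  then show ?thesis
    unfolding card_gt_0_iff using finite_meeting_cosets[OF compact U Int_lower2]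
    by (auto simp: meeting_cosets_def)
qed

lemma eventually_growth_factor:
  "\<exists>N. \<forall>n\<ge>N. cotraj_index (Suc n) = cotraj_index n * growth_factor"
proof -
  have "decseq (\<lambda>n. \<psi> -` cotraj_n K \<psi> U n \<inter> carrier K)"
    using decseq_cotraj[of U] by (fastforce simp: decseq_def)
  from meeting_cosets_decseq[OF compact U closedin_vimage[OF closedin_cotraj] this]
  show ?thesis
    unfolding vimage_U_minus index_cotraj_Suc by metis
qed

section \<open>The entropy with respect to an open subgroup\<close>

lemma tendsto_log_cotraj_index: "(\<lambda>n. ln (cotraj_index n) / n) \<longlonglongrightarrow> ln growth_factor"
proof -
  obtain N where N: "cotraj_index (Suc n) = cotraj_index n * growth_factor" if "n \<ge> N" for n
    using eventually_growth_factor by blast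
  have "cotraj_index (N + m) = cotraj_index N * growth_factor ^ m" for m
    by (induction m) (simp_all add: N)
  then have *: "ln (cotraj_index (N + m)) = ln (cotraj_index N) + m * ln growth_factor" for m
    using cotraj_index_pos[of N] growth_factor_pos by (simp add: ln_mult ln_realpow)
  define a where "a = ln (cotraj_index N) - N * ln growth_factor"
  have "ln (cotraj_index n) / n = a * (1 / n) + ln growth_factor" if "n \<ge> Suc N" for n
  proof -
    have "ln (cotraj_index n) = ln (cotraj_index N) + real (n - N) * ln growth_factor"
      using *[of "n - N"] that by simp
    then show ?thesis
      using that by (simp add: a_def of_nat_diff field_simps)
  qed
  then have "\<forall>\<^sub>F n in sequentially. a * (1 / n) + ln growth_factor = ln (cotraj_index n) / n"
    unfolding eventually_sequentially by metis
  moreover have "(\<lambda>n. a * (1 / n) + ln growth_factor) \<longlonglongrightarrow> a * 0 + ln growth_factor"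
    by (intro tendsto_intros lim_1_over_n)
  ultimately show ?thesis
    by (simp add: Lim_transform_eventually)
qed

lemma H_top_eq: "H_top K \<psi> U = ereal (ln growth_factor)"
proof -
  have "(\<lambda>n. ereal (ln (cotraj_index n) / n)) \<longlonglongrightarrow> ereal (ln growth_factor)"
    using tendsto_log_cotraj_index by simp
  moreover have "\<forall>\<^sub>F n in sequentially. ereal (ln (cotraj_index n) / n) =
      log_index (subgroup_index K (carrier K) (cotraj_n K \<psi> U n)) / ereal (real n)"
    using eventually_gt_at_top[of 0]
    by eventually_elim (simp add: subgroup_index_cotraj log_index_def)
  ultimately have "(\<lambda>n. log_index (subgroup_index K (carrier K) (cotraj_n K \<psi> U n)) /
      ereal (real n)) \<longlonglongrightarrow> ereal (ln growth_factor)"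
    by (rule Lim_transform_eventually)
  then show ?thesis
    unfolding H_top_def by (rule limI)
qed

lemma H_top_eq_log_index:
  "H_top K \<psi> U = log_index (subgroup_index K (\<psi> -` U_minus K \<psi> U \<inter> carrier K) (U_minus K \<psi> U))"
  by (simp add: H_top_eq subgroup_index_U_minus log_index_def)

section \<open>The forward trajectory\<close>

lemma U_plus_sub: "U_plus \<psi> U \<subseteq> U"
proof -
  have "U_plus \<psi> U \<subseteq> (\<psi> ^^ 0) ` U"
    unfolding U_plus_def by blast
  then show ?thesis
    by simp
qed

lemma subgroup_U_plus: "subgroup (U_plus \<psi> U) K"
  unfolding U_plus_def
proof (rule subgroups_Inter)
  show "subgroup H K" if "H \<in> range (\<lambda>n. (\<psi> ^^ n) ` U)" for H
    using that subgroup_image_hom[OF funpow_hom U(1)] by blast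
qed simp

lemma image_U_plus_Int:
  assumes "U_plus \<psi> U \<subseteq> \<psi> ` U_plus \<psi> U"
  shows "\<psi> ` U_plus \<psi> U \<inter> U = U_plus \<psi> U"
proof
  show "\<psi> ` U_plus \<psi> U \<inter> U \<subseteq> U_plus \<psi> U"
  proof
    fix y assume y: "y \<in> \<psi> ` U_plus \<psi> U \<inter> U"
    then obtain x where x: "x \<in> U_plus \<psi> U" "y = \<psi> x"
      by auto
    have "y \<in> (\<psi> ^^ n) ` U" for n
    proof (cases n)
      case (Suc m)
      have "x \<in> (\<psi> ^^ m) ` U"
        using x by (auto simp: U_plus_def)
      then show ?thesis
        using x Suc by auto
    qed (use y in simp)
    then show "y \<in> U_plus \<psi> U"
      by (auto simp: U_plus_def)
  qed
qed (use assms U_plus_sub in blast)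

lemma image_cotraj_Suc_sub: "\<psi> ` cotraj_n K \<psi> U (Suc n) \<subseteq> cotraj_n K \<psi> U n"
  by (auto simp: cotraj_Suc')

lemma decseq_image_cotraj: "decseq (\<lambda>n. (\<psi> ^^ n) ` cotraj_n K \<psi> U (n + k))"
proof (rule decseq_SucI)
  fix n
  have "(\<psi> ^^ Suc n) ` cotraj_n K \<psi> U (Suc n + k) = (\<psi> ^^ n) ` \<psi> ` cotraj_n K \<psi> U (Suc (n + k))"
    by (simp only: funpow_Suc_right image_comp add_Suc)
  then show "(\<psi> ^^ Suc n) ` cotraj_n K \<psi> U (Suc n + k) \<subseteq> (\<psi> ^^ n) ` cotraj_n K \<psi> U (n + k)"
    using image_cotraj_Suc_sub[of "n + k"] by blast
qed

text \<open>Points of \<open>\<psi>\<^sup>n(C\<^sub>n)\<close> end an orbit segment whose \<open>n\<close> earlier points all lie in \<open>U\<close>. If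
  \<open>U\<^sub>+ \<subseteq> \<psi>(U\<^sub>+)\<close>, then points of \<open>U\<^sub>+\<close> have arbitrarily long backward orbits inside \<open>U\<^sub>+\<close>.\<close>

lemma image_U_plus_sub_image_cotraj:
  assumes sub: "U_plus \<psi> U \<subseteq> \<psi> ` U_plus \<psi> U"
  shows "\<psi> ` U_plus \<psi> U \<subseteq> (\<psi> ^^ n) ` cotraj_n K \<psi> U n"
proof -
  have "\<exists>x\<in>cotraj_n K \<psi> U n. x \<in> \<psi> ` U_plus \<psi> U \<and> (\<psi> ^^ n) x = y" if "y \<in> \<psi> ` U_plus \<psi> U" for y
  proof (induction n)
    case 0
    then show ?case
      using that subgroup_image_hom[OF hom subgroup_U_plus, THEN subgroup.subset]
      by (auto simp: cotraj_0)
  next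
    case (Suc n)
    then obtain x where x: "x \<in> cotraj_n K \<psi> U n" "x \<in> \<psi> ` U_plus \<psi> U" "(\<psi> ^^ n) x = y"
      by blast
    then obtain z where z: "z \<in> U_plus \<psi> U" "x = \<psi> z"
      by auto
    then have "z \<in> U"
      using U_plus_sub by auto
    then have "z \<in> cotraj_n K \<psi> U (Suc n)"
      using x z U subgroup.mem_carrier by (auto simp: cotraj_Suc')
    moreover have "(\<psi> ^^ Suc n) z = y"
      using x z by (simp add: funpow_swap1)
    ultimately show ?case
      using z sub by blast
  qed
  then show ?thesis
    by (metis image_eqI subsetI)
qed

text \<open>The converse inclusion needs compactness: a point \<open>y\<close> of all \<open>\<psi>\<^sup>n(C\<^sub>n)\<close> has for each \<open>n\<close> a preimage in
  \<open>\<psi>\<^sup>n(C\<^bsub>n+1\<^esub>)\<close>, and these closed sets of preimages decrease.\<close>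

lemma Inter_image_cotraj_sub:
  "(\<Inter>n. (\<psi> ^^ n) ` cotraj_n K \<psi> U n) \<subseteq> \<psi> ` U_plus \<psi> U"
proof
  fix y assume y: "y \<in> (\<Inter>n. (\<psi> ^^ n) ` cotraj_n K \<psi> U n)"
  then have "y \<in> (\<psi> ^^ 0) ` cotraj_n K \<psi> U 0"
    by blast
  then have yc: "y \<in> carrier K"
    by (simp add: cotraj_0)
  define A where "A = (\<lambda>n. (\<psi> -` {y} \<inter> carrier K) \<inter> (\<psi> ^^ n) ` cotraj_n K \<psi> U (n + 1))"
  have "(\<Inter>n. A n) \<noteq> {}"
  proof (rule compact_space_imp_nest[OF compact])
    show "closedin T (A n)" for n
      unfolding A_def using Hausdorff yc
      by (intro closedin_Int closedin_vimage closedin_image closedin_cotraj)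
         (simp add: closedin_Hausdorff_singleton)
    show "decseq A"
      using decseq_image_cotraj[of 1] unfolding A_def decseq_def by blast
    show "A n \<noteq> {}" for n
    proof -
      have "y \<in> (\<psi> ^^ Suc n) ` cotraj_n K \<psi> U (Suc n)"
        using y by blast
      then obtain x where x: "x \<in> cotraj_n K \<psi> U (Suc n)" "y = \<psi> ((\<psi> ^^ n) x)"
        by auto
      moreover have "x \<in> carrier K"
        using x by (simp add: cotraj_n_def)
      ultimately have "(\<psi> ^^ n) x \<in> A n"
        by (auto simp: A_def)
      then show ?thesis
        by blast
    qed
  qed
  then obtain x where x: "\<And>n. x \<in> A n"
    by auto
  have "x \<in> (\<psi> ^^ n) ` U" for n
  proof -
    have "cotraj_n K \<psi> U (n + 1) \<subseteq> U"
      by (auto simp: cotraj_Suc')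
    then show ?thesis
      using x[of n] by (auto simp: A_def)
  qed
  then have "x \<in> U_plus \<psi> U"
    by (auto simp: U_plus_def)
  then show "y \<in> \<psi> ` U_plus \<psi> U"
    using x[of 0] by (auto simp: A_def)
qed

lemma subgroup_index_U_plus:
  assumes "U_plus_index_defined K \<psi> U"
  shows "subgroup_index K (\<psi> ` U_plus \<psi> U) (U_plus \<psi> U) = enat growth_factor"
proof -
  have sub: "U_plus \<psi> U \<subseteq> \<psi> ` U_plus \<psi> U"
    using assms subgroup.subset by (fastforce simp: U_plus_index_defined_def)
  have img: "subgroup (\<psi> ` U_plus \<psi> U) K"
    using hom subgroup_U_plus by (rule subgroup_image_hom)
  have Inter: "(\<Inter>n. (\<psi> ^^ n) ` cotraj_n K \<psi> U n) = \<psi> ` U_plus \<psi> U"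
    using Inter_image_cotraj_sub image_U_plus_sub_image_cotraj[OF sub] by blast
  have "decseq (\<lambda>n. (\<psi> ^^ n) ` cotraj_n K \<psi> U n)"
    using decseq_image_cotraj[of 0] by simp
  from meeting_cosets_decseq[OF compact U closedin_image[OF closedin_cotraj] this]
  obtain N where N: "meeting_cosets K U ((\<psi> ^^ n) ` cotraj_n K \<psi> U n) =
      meeting_cosets K U (\<psi> ` U_plus \<psi> U)" if "n \<ge> N" for n
    unfolding Inter by blast
  obtain M where M: "cotraj_index (Suc n) = cotraj_index n * growth_factor" if "n \<ge> M" for n
    using eventually_growth_factor by blast
  have "card (meeting_cosets K U (\<psi> ` U_plus \<psi> U)) = growth_factor"
    using N[of "max M N"] M[of "max M N"] index_cotraj_Suc'[of "max M N"]
      cotraj_index_pos[of "max M N"] by simp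
  then show ?thesis
    using subgroup_index_eq_card_meeting[OF img U(1)
      finite_meeting_cosets[OF compact U subgroup.subset[OF img]]]
    by (simp add: image_U_plus_Int[OF sub])
qed

end

section \<open>The total entropy\<close>

lemma H_top_antimono:
  assumes U: "subgroup U K" "openin T U" and V: "subgroup V K" "openin T V" and "V \<subseteq> U"
  shows "H_top K \<psi> U \<le> H_top K \<psi> V"
proof -
  have "cotraj_index U n \<le> cotraj_index V n" for n
    unfolding cotraj_index_def[OF U] cotraj_index_def[OF V]
    using cotraj_mono[OF \<open>V \<subseteq> U\<close>] compact
    by (intro card_meeting_antimono finite_meeting_cosets subgroup_cotraj openin_cotraj U V
      order_refl)
  then have "ln (cotraj_index U n) / n \<le> ln (cotraj_index V n) / n" for n
    using cotraj_index_pos[OF U] cotraj_index_pos[OF V] by (intro divide_right_mono) auto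
  then show ?thesis
    using LIMSEQ_le[OF tendsto_log_cotraj_index[OF U] tendsto_log_cotraj_index[OF V]]
    by (simp add: H_top_eq[OF U] H_top_eq[OF V])
qed

lemma h_top_eq_SUP_normal: "h_top K T \<psi> = (SUP U \<in> open_normal_subgroups K T. H_top K \<psi> U)"
  unfolding h_top_def
proof (rule antisym; rule SUP_mono)
  fix U assume "U \<in> open_subgroups K T"
  then have U: "subgroup U K" "openin T U"
    by (auto simp: open_subgroups_def)
  obtain N where N: "N \<in> open_normal_subgroups K T" "N \<subseteq> U"
    using open_normal_subgroup_below[OF compact U] .
  then show "\<exists>N\<in>open_normal_subgroups K T. H_top K \<psi> U \<le> H_top K \<psi> N"
    using H_top_antimono[OF U, of N] normal_imp_subgroup[of N K]
    by (auto simp: open_normal_subgroups_def)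
next
  fix N assume "N \<in> open_normal_subgroups K T"
  then show "\<exists>U\<in>open_subgroups K T. H_top K \<psi> N \<le> H_top K \<psi> U"
    using normal_imp_subgroup[of N K]
    by (auto simp: open_normal_subgroups_def open_subgroups_def)
qed

end

theorem corollary3p6:
  fixes K :: "('a, 'b) monoid_scheme" and T :: "'a topology" and \<psi> :: "'a \<Rightarrow> 'a"
  assumes "td_compact_group K T"
    and "\<psi> \<in> hom K K" and "continuous_map T T \<psi>" and "\<psi> ` carrier K = carrier K"
  shows "(\<forall>U \<in> open_normal_subgroups K T.
            H_top K \<psi> U =
              log_index (subgroup_index K (\<psi> -` U_minus K \<psi> U \<inter> carrier K) (U_minus K \<psi> U)) \<and>
            (U_plus_index_defined K \<psi> U \<longrightarrow>
              subgroup_index K (\<psi> -` U_minus K \<psi> U \<inter> carrier K) (U_minus K \<psi> U) =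
              subgroup_index K (\<psi> ` U_plus \<psi> U) (U_plus \<psi> U))) \<and>
         h_top K T \<psi> =
           (SUP U \<in> open_normal_subgroups K T.
              log_index (subgroup_index K (\<psi> -` U_minus K \<psi> U \<inter> carrier K) (U_minus K \<psi> U)))"
proof -
  interpret td_compact_group K T
    by (rule assms)
  interpret compact_group_epimorphism K T \<psi>
    by unfold_locales (fact compact Hausdorff assms)+
  have "subgroup U K \<and> openin T U" if "U \<in> open_normal_subgroups K T" for U
    using that normal_imp_subgroup by (auto simp: open_normal_subgroups_def)
  then show ?thesis
    by (simp add: h_top_eq_SUP_normal H_top_eq_log_index subgroup_index_U_minus
        subgroup_index_U_plus cong: SUP_cong)
qed

end
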